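(* There exist a locally compact group $G$ and a $G$-invariant ideal $E$ of the Fourier-Stieltjes algebra $B(G)$ such that $E$ is weakly ordered but not ordered.
   Context: $B(G)$ is the Fourier-Stieltjes algebra of $G$ (coefficient functions $x\mapsto\langle U_x\xi,\eta\rangle$ of strongly continuous unitary representations $U$ of $G$), an algebra under pointwise operations, identified with the Banach space dual $C^*(G)^*$ of the full group $C^*$-algebra and given the corresponding weak* topology. Ideals of $B(G)$ are not assumed closed in any topology. A subspace of $B(G)$ is $G$-invariant if it is invariant under left and right translation by elements of $G$. $P(G)\subset B(G)$ is the set of continuous positive definite functions on $G$. For a subspace $E$ of $B(G)$ let $E_0=\operatorname{span}\{E\cap P(G)\}$. $E$ is ordered if $E_0=E$, and weakly ordered if $E_0$ is weak* dense in $E$ (i.e. $E$ is contained in the weak* closure of $E_0$). *)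

theory Defs
  imports "HOL-Analysis.Analysis" "HOL-Algebra.Group" "HOL-Library.Function_Algebras"
begin

text \<open>
  Complex vector spaces are complex-linear subspaces of a function space
  \<^typ>\<open>'i \<Rightarrow> complex\<close> with the pointwise operations. Functions on a group \<open>G\<close> are
  represented by functions on the ambient type that vanish off \<^term>\<open>carrier G\<close>.
\<close>

definition cscale :: "complex \<Rightarrow> ('i \<Rightarrow> complex) \<Rightarrow> 'i \<Rightarrow> complex"
  where "cscale c f = (\<lambda>x. c * f x)"

global_interpretation cfun: vector_space "cscale :: complex \<Rightarrow> ('i \<Rightarrow> complex) \<Rightarrow> 'i \<Rightarrow> complex"
  by unfold_locales (auto simp: cscale_def fun_eq_iff algebra_simps)


section \<open>Locally compact groups and Haar measure\<close>

locale locally_compact_group = group G for G :: "('a, 'b) monoid_scheme" (structure) +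
  fixes T :: "'a topology"
  assumes topspace_eq_carrier: "topspace T = carrier G"
    and continuous_mult: "continuous_map (prod_topology T T) T (\<lambda>(x, y). x \<otimes> y)"
    and continuous_inv: "continuous_map T T (\<lambda>x. inv x)"
    and Hausdorff: "Hausdorff_space T"
    and locally_compact: "locally_compact_space T"

definition left_haar_measure ::
    "('a, 'b) monoid_scheme \<Rightarrow> 'a topology \<Rightarrow> 'a measure \<Rightarrow> bool"
  where "left_haar_measure G T \<mu> \<longleftrightarrow>
    sets \<mu> = sigma_sets (topspace T) {W. openin T W} \<and>
    (\<forall>K. compactin T K \<longrightarrow> emeasure \<mu> K < \<infinity>) \<and>
    (\<forall>A \<in> sets \<mu>. emeasure \<mu> A = (INF W\<in>{W. openin T W \<and> A \<subseteq> W}. emeasure \<mu> W)) \<and>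
    (\<forall>W. openin T W \<longrightarrow> emeasure \<mu> W = (SUP K\<in>{K. compactin T K \<and> K \<subseteq> W}. emeasure \<mu> K)) \<and>
    (\<forall>g \<in> carrier G. \<forall>A \<in> sets \<mu>. emeasure \<mu> ((\<lambda>x. g \<otimes>\<^bsub>G\<^esub> x) ` A) = emeasure \<mu> A) \<and>
    emeasure \<mu> (space \<mu>) \<noteq> 0"


section \<open>Unitary representations on complex Hilbert spaces\<close>

definition hnorm :: "('v \<Rightarrow> 'v \<Rightarrow> complex) \<Rightarrow> 'v \<Rightarrow> real"
  where "hnorm ip u = sqrt (Re (ip u u))"

text \<open>The inner product is linear in the first variable. Its values off \<open>H\<close> are irrelevant.\<close>

locale complex_hilbert_space =
  fixes H :: "('i \<Rightarrow> complex) set" and ip :: "('i \<Rightarrow> complex) \<Rightarrow> ('i \<Rightarrow> complex) \<Rightarrow> complex"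
  assumes subspace: "cfun.subspace H"
    and ip_add: "\<lbrakk>u \<in> H; v \<in> H; w \<in> H\<rbrakk> \<Longrightarrow> ip (u + v) w = ip u w + ip v w"
    and ip_scale: "\<lbrakk>u \<in> H; v \<in> H\<rbrakk> \<Longrightarrow> ip (cscale c u) v = c * ip u v"
    and ip_commute: "\<lbrakk>u \<in> H; v \<in> H\<rbrakk> \<Longrightarrow> ip v u = cnj (ip u v)"
    and ip_nonneg: "u \<in> H \<Longrightarrow> Re (ip u u) \<ge> 0"
    and ip_definite: "\<lbrakk>u \<in> H; ip u u = 0\<rbrakk> \<Longrightarrow> u = 0"
    and complete: "\<lbrakk>\<And>n. X n \<in> H; \<forall>e>0. \<exists>N. \<forall>m\<ge>N. \<forall>n\<ge>N. hnorm ip (X m - X n) < e\<rbrakk>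
        \<Longrightarrow> \<exists>l\<in>H. (\<lambda>n. hnorm ip (X n - l)) \<longlonglongrightarrow> 0"

text \<open>The last assumption is continuity in the strong operator topology.\<close>

locale unitary_rep =
  complex_hilbert_space H ip + locally_compact_group G T
  for G :: "('a, 'b) monoid_scheme" (structure) and T
    and H :: "('i \<Rightarrow> complex) set" and ip +
  fixes U :: "'a \<Rightarrow> ('i \<Rightarrow> complex) \<Rightarrow> ('i \<Rightarrow> complex)"
  assumes U_bij: "x \<in> carrier G \<Longrightarrow> bij_betw (U x) H H"
    and U_add: "\<lbrakk>x \<in> carrier G; u \<in> H; v \<in> H\<rbrakk> \<Longrightarrow> U x (u + v) = U x u + U x v"
    and U_scale: "\<lbrakk>x \<in> carrier G; u \<in> H\<rbrakk> \<Longrightarrow> U x (cscale c u) = cscale c (U x u)"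
    and U_isometric: "\<lbrakk>x \<in> carrier G; u \<in> H; v \<in> H\<rbrakk> \<Longrightarrow> ip (U x u) (U x v) = ip u v"
    and U_mult: "\<lbrakk>x \<in> carrier G; y \<in> carrier G; u \<in> H\<rbrakk> \<Longrightarrow> U (x \<otimes> y) u = U x (U y u)"
    and U_continuous: "\<lbrakk>x \<in> carrier G; u \<in> H\<rbrakk>
        \<Longrightarrow> ((\<lambda>y. hnorm ip (U y u - U x u)) \<longlongrightarrow> 0) (atin T x)"


section \<open>The Fourier-Stieltjes algebra\<close>

definition coeff_fun ::
    "('a, 'b) monoid_scheme \<Rightarrow> ('v \<Rightarrow> 'v \<Rightarrow> complex) \<Rightarrow> ('a \<Rightarrow> 'v \<Rightarrow> 'v) \<Rightarrow> 'v \<Rightarrow> 'v \<Rightarrow> 'a \<Rightarrow> complex"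
  where "coeff_fun G ip U \<xi> \<eta> = (\<lambda>x. if x \<in> carrier G then ip (U x \<xi>) \<eta> else 0)"

text \<open>
  It suffices to let the Hilbert spaces range over subspaces of \<^typ>\<open>'a \<Rightarrow> complex\<close> with an
  arbitrary inner product, where \<^typ>\<open>'a\<close> is the type of the group elements. Replacing the
  Hilbert space by the closed linear span of the orbit of \<open>\<xi>\<close>, and \<open>\<eta>\<close> by its projection to
  this span, does not change the coefficient \<open>x \<mapsto> \<langle>U\<^sub>x \<xi>, \<eta>\<rangle>\<close> and does not increase \<open>\<parallel>\<eta>\<parallel>\<close>.
  On the span the map \<open>\<zeta> \<mapsto> (x \<mapsto> \<langle>\<zeta>, U\<^sub>x \<xi>\<rangle>)\<close> is linear and injective, so the
  representation can be transported to a space of functions on the group. The same argument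
  applies to the supremum defining the norm of \<open>C\<^sup>*(G)\<close> below.
\<close>

definition fourier_stieltjes :: "('a, 'b) monoid_scheme \<Rightarrow> 'a topology \<Rightarrow> ('a \<Rightarrow> complex) set"
  where "fourier_stieltjes G T =
    {coeff_fun G ip U \<xi> \<eta> | (H :: ('a \<Rightarrow> complex) set) ip U \<xi> \<eta>.
       unitary_rep G T H ip U \<and> \<xi> \<in> H \<and> \<eta> \<in> H}"

definition pos_def_funs :: "('a, 'b) monoid_scheme \<Rightarrow> 'a topology \<Rightarrow> ('a \<Rightarrow> complex) set"
  where "pos_def_funs G T =
    {f. continuous_map T euclidean f \<and> (\<forall>x. x \<notin> carrier G \<longrightarrow> f x = 0) \<and>
        (\<forall>F c. finite F \<and> F \<subseteq> carrier G \<longrightarrow>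
           (\<Sum>x\<in>F. \<Sum>y\<in>F. c x * cnj (c y) * f (inv\<^bsub>G\<^esub> y \<otimes>\<^bsub>G\<^esub> x)) \<in> \<real>\<^sub>\<ge>\<^sub>0)}"


section \<open>The full group C*-algebra and the weak* topology\<close>

text \<open>
  The norm \<open>\<parallel>f\<parallel> = sup\<^sub>U \<parallel>U(f)\<parallel>\<close> on \<open>L\<^sup>1(G)\<close>, where the integrated form \<open>U(f) = \<integral> f(x) U\<^sub>x dx\<close>
  is the operator with \<open>\<langle>U(f) \<xi>, \<eta>\<rangle> = \<integral> f(x) \<langle>U\<^sub>x \<xi>, \<eta>\<rangle> dx\<close>. The supremum is finite,
  being bounded by the \<open>L\<^sup>1\<close>-norm.
\<close>

definition cstar_norm ::
    "('a, 'b) monoid_scheme \<Rightarrow> 'a topology \<Rightarrow> 'a measure \<Rightarrow> ('a \<Rightarrow> complex) \<Rightarrow> real"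
  where "cstar_norm G T \<mu> f =
    Sup {cmod (\<integral>x. f x * ip (U x \<xi>) \<eta> \<partial>\<mu>) | (H :: ('a \<Rightarrow> complex) set) ip U \<xi> \<eta>.
       unitary_rep G T H ip U \<and> \<xi> \<in> H \<and> \<eta> \<in> H \<and> hnorm ip \<xi> \<le> 1 \<and> hnorm ip \<eta> \<le> 1}"

definition cstar_Cauchy ::
    "('a, 'b) monoid_scheme \<Rightarrow> 'a topology \<Rightarrow> 'a measure \<Rightarrow> (nat \<Rightarrow> 'a \<Rightarrow> complex) set"
  where "cstar_Cauchy G T \<mu> =
    {S. (\<forall>n. integrable \<mu> (S n)) \<and>
        (\<forall>e>0. \<exists>N. \<forall>m\<ge>N. \<forall>n\<ge>N. cstar_norm G T \<mu> (S m - S n) < e)}"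

definition cstar_equiv ::
    "('a, 'b) monoid_scheme \<Rightarrow> 'a topology \<Rightarrow> 'a measure \<Rightarrow> (nat \<Rightarrow> 'a \<Rightarrow> complex) rel"
  where "cstar_equiv G T \<mu> =
    {(S, S'). S \<in> cstar_Cauchy G T \<mu> \<and> S' \<in> cstar_Cauchy G T \<mu> \<and>
        (\<lambda>n. cstar_norm G T \<mu> (S n - S' n)) \<longlonglongrightarrow> 0}"

text \<open>
  The underlying set of \<open>C\<^sup>*(G)\<close>, the completion of \<open>L\<^sup>1(G)\<close>. The weak* topology
  only depends on the pairing of this set with \<open>B(G)\<close>, so the algebra structure is not needed.
\<close>

definition group_cstar ::
    "('a, 'b) monoid_scheme \<Rightarrow> 'a topology \<Rightarrow> 'a measure \<Rightarrow> (nat \<Rightarrow> 'a \<Rightarrow> complex) set set"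
  where "group_cstar G T \<mu> = cstar_Cauchy G T \<mu> // cstar_equiv G T \<mu>"

text \<open>
  The identification of \<open>B(G)\<close> with the dual of \<open>C\<^sup>*(G)\<close>: a function \<open>\<phi>\<close> in \<open>B(G)\<close> acts as the
  continuous extension of \<open>f \<mapsto> \<integral> f(x) \<phi>(x) dx\<close> from \<open>L\<^sup>1(G)\<close>.
\<close>

definition cstar_pairing :: "'a measure \<Rightarrow> ('a \<Rightarrow> complex) \<Rightarrow> (nat \<Rightarrow> 'a \<Rightarrow> complex) set \<Rightarrow> complex"
  where "cstar_pairing \<mu> \<phi> a = (THE c. \<forall>S\<in>a. (\<lambda>n. \<integral>x. S n x * \<phi> x \<partial>\<mu>) \<longlonglongrightarrow> c)"

definition weak_star_topology ::
    "('a, 'b) monoid_scheme \<Rightarrow> 'a topology \<Rightarrow> 'a measure \<Rightarrow> ('a \<Rightarrow> complex) topology"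
  where "weak_star_topology G T \<mu> =
    pullback_topology (fourier_stieltjes G T)
      (\<lambda>\<phi>. \<lambda>a\<in>group_cstar G T \<mu>. cstar_pairing \<mu> \<phi> a)
      (product_topology (\<lambda>_. euclidean) (group_cstar G T \<mu>))"


section \<open>Invariant ideals and order properties\<close>

definition fs_ideal :: "('a, 'b) monoid_scheme \<Rightarrow> 'a topology \<Rightarrow> ('a \<Rightarrow> complex) set \<Rightarrow> bool"
  where "fs_ideal G T E \<longleftrightarrow>
    E \<subseteq> fourier_stieltjes G T \<and> cfun.subspace E \<and>
    (\<forall>b \<in> fourier_stieltjes G T. \<forall>f \<in> E. b * f \<in> E)"

definition G_invariant :: "('a, 'b) monoid_scheme \<Rightarrow> ('a \<Rightarrow> complex) set \<Rightarrow> bool"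
  where "G_invariant G E \<longleftrightarrow>
    (\<forall>g \<in> carrier G. \<forall>f \<in> E.
       (\<lambda>x. if x \<in> carrier G then f (g \<otimes>\<^bsub>G\<^esub> x) else 0) \<in> E \<and>
       (\<lambda>x. if x \<in> carrier G then f (x \<otimes>\<^bsub>G\<^esub> g) else 0) \<in> E)"

definition pos_part ::
    "('a, 'b) monoid_scheme \<Rightarrow> 'a topology \<Rightarrow> ('a \<Rightarrow> complex) set \<Rightarrow> ('a \<Rightarrow> complex) set"
  where "pos_part G T E = cfun.span (E \<inter> pos_def_funs G T)"

definition ordered :: "('a, 'b) monoid_scheme \<Rightarrow> 'a topology \<Rightarrow> ('a \<Rightarrow> complex) set \<Rightarrow> bool"
  where "ordered G T E \<longleftrightarrow> pos_part G T E = E"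

text \<open>
  The Haar measure is unique up to a positive factor, which does not affect the weak* topology,
  so this does not depend on the choice of \<open>\<mu>\<close>.
\<close>

definition weakly_ordered ::
    "('a, 'b) monoid_scheme \<Rightarrow> 'a topology \<Rightarrow> 'a measure \<Rightarrow> ('a \<Rightarrow> complex) set \<Rightarrow> bool"
  where "weakly_ordered G T \<mu> E \<longleftrightarrow>
    E \<subseteq> weak_star_topology G T \<mu> closure_of pos_part G T E"

end

(*
  Take G to be the integers with the discrete topology, and let E consist of the square-summable
  functions whose support is bounded below. Every square-summable f is the coefficient
  <U_x delta_0, conj f> of the regular representation, and elements of B(G) are bounded, so E is
  an ideal of B(G); it is clearly translation invariant. A positive definite function is Hermitian,
  so one in E has finite support, and E is not ordered because it contains a function of infinite
  support. Conversely, by polarization every finitely supported function is a combination of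
  finitely supported positive definite functions, and such functions are norm dense in E because
  the norm of B(G) is dominated by the l2-norm on square-summable functions.
*)
theory Submission
  imports Defs
begin

section \<open>Complex Hilbert spaces\<close>

context complex_hilbert_space
begin

lemma add_in: "u \<in> H \<Longrightarrow> v \<in> H \<Longrightarrow> u + v \<in> H"
  using cfun.subspace_add[OF subspace] .

lemma scale_in: "u \<in> H \<Longrightarrow> cscale c u \<in> H"
  using cfun.subspace_scale[OF subspace] .

lemma zero_in: "0 \<in> H"
  using cfun.subspace_0[OF subspace] .

lemma sum_in: "(\<And>x. x \<in> F \<Longrightarrow> u x \<in> H) \<Longrightarrow> sum u F \<in> H"
  using cfun.subspace_sum[OF subspace] .

lemma ip_zero_left: "v \<in> H \<Longrightarrow> ip 0 v = 0"
  using ip_scale[of 0 v 0] zero_in by (simp add: cfun.scale_zero_left)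

lemma ip_add_right: "\<lbrakk>u \<in> H; v \<in> H; w \<in> H\<rbrakk> \<Longrightarrow> ip w (u + v) = ip w u + ip w v"
  by (metis add_in complex_cnj_add ip_add ip_commute)

lemma ip_scale_right: "\<lbrakk>u \<in> H; v \<in> H\<rbrakk> \<Longrightarrow> ip v (cscale c u) = cnj c * ip v u"
  by (metis complex_cnj_mult ip_commute ip_scale scale_in)

lemma ip_sum_left:
  assumes "finite F" "\<And>x. x \<in> F \<Longrightarrow> u x \<in> H" "v \<in> H"
  shows "ip (sum u F) v = (\<Sum>x\<in>F. ip (u x) v)"
  using assms by (induction F) (auto simp: ip_zero_left ip_add sum_in)

lemma ip_sum_right:
  assumes "finite F" "\<And>x. x \<in> F \<Longrightarrow> u x \<in> H" "v \<in> H"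
  shows "ip v (sum u F) = (\<Sum>x\<in>F. ip v (u x))"
proof -
  have "ip v (sum u F) = cnj (ip (sum u F) v)"
    using assms by (intro ip_commute sum_in) auto
  also have "\<dots> = (\<Sum>x\<in>F. cnj (ip (u x) v))"
    using assms by (simp add: ip_sum_left)
  also have "\<dots> = (\<Sum>x\<in>F. ip v (u x))"
    using assms by (intro sum.cong) (auto simp: ip_commute[symmetric])
  finally show ?thesis .
qed

lemma ip_self: "u \<in> H \<Longrightarrow> ip u u = of_real ((hnorm ip u)\<^sup>2)"
  using ip_commute[of u u] ip_nonneg[of u]
  by (auto simp: hnorm_def complex_eq_iff)

text \<open>The squared norm of \<open>u + cscale c v\<close> is nonnegative for every scalar; the
  inequality is this fact at the minimising scalar.\<close>

lemma Cauchy_Schwarz: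
  assumes u: "u \<in> H" and v: "v \<in> H"
  shows "cmod (ip u v) \<le> hnorm ip u * hnorm ip v"
proof (cases "ip v v = 0")
  case True
  then have "v = 0" using ip_definite v by blast
  then have "ip u v = 0" using ip_zero_left[OF u] ip_commute[OF zero_in u] by simp
  then show ?thesis using ip_nonneg u v by (simp add: hnorm_def)
next
  case False
  define a b where "a = (hnorm ip u)\<^sup>2" and "b = (hnorm ip v)\<^sup>2"
  have b: "b > 0" using False ip_self[OF v] by (auto simp: b_def)
  \<comment> \<open>With this choice \<open>u + cscale c v\<close> is the component of
    \<open>u\<close> orthogonal to \<open>v\<close>.\<close>
  define c where "c = - ip u v / of_real b"
  have cv: "cscale c v \<in> H" using v by (rule scale_in)
  have "ip (u + cscale c v) (u + cscale c v) =
      ip u u + cnj c * ip u v + c * cnj (ip u v) + c * cnj c * ip v v"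
    using u v cv by (simp add: ip_add ip_add_right add_in ip_scale ip_scale_right
        ip_commute[OF u v] algebra_simps)
  also have "\<dots> = of_real a - ip u v * cnj (ip u v) / of_real b"
    using b by (simp add: c_def ip_self[OF u] ip_self[OF v] flip: a_def b_def)
  also have "\<dots> = of_real (a - (cmod (ip u v))\<^sup>2 / b)"
    by (simp flip: complex_norm_square)
  finally have "a - (cmod (ip u v))\<^sup>2 / b \<ge> 0"
    using ip_nonneg[OF add_in[OF u cv]] by simp
  then have "(cmod (ip u v))\<^sup>2 \<le> (hnorm ip u * hnorm ip v)\<^sup>2"
    using b by (simp add: field_simps a_def b_def)
  then show ?thesis
    by (rule power2_le_imp_le) (use ip_nonneg u v in \<open>simp add: hnorm_def\<close>)
qed

end

section \<open>Coefficients of unitary representations: bound, positivity, polarization\<close>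

context unitary_rep
begin

lemma U_in: "x \<in> carrier G \<Longrightarrow> u \<in> H \<Longrightarrow> U x u \<in> H"
  using U_bij[of x] by (auto dest: bij_betwE)

lemma cmod_coeff_le:
  assumes "\<xi> \<in> H" "\<eta> \<in> H" "x \<in> carrier G"
  shows "cmod (ip (U x \<xi>) \<eta>) \<le> hnorm ip \<xi> * hnorm ip \<eta>"
  using Cauchy_Schwarz[of "U x \<xi>" \<eta>] assms by (simp add: U_in hnorm_def U_isometric)

text \<open>The quadratic form of a diagonal coefficient is the squared norm of the vector
  \<open>\<Sum>x\<in>F. cscale (c x) (U x \<xi>)\<close>. Discreteness of \<open>T\<close> makes
  continuity automatic.\<close>

lemma coeff_diag_pos_def:
  assumes T: "T = discrete_topology (carrier G)" and \<xi>: "\<xi> \<in> H"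
  shows "coeff_fun G ip U \<xi> \<xi> \<in> pos_def_funs G T"
proof -
  have "(\<Sum>x\<in>F. \<Sum>y\<in>F. c x * cnj (c y) * coeff_fun G ip U \<xi> \<xi> (inv y \<otimes> x)) \<in> \<real>\<^sub>\<ge>\<^sub>0"
    if F: "finite F" "F \<subseteq> carrier G" for F c
  proof -
    let ?v = "\<Sum>x\<in>F. cscale (c x) (U x \<xi>)"
    have in_H: "cscale (c x) (U x \<xi>) \<in> H" if "x \<in> F" for x
      using that F \<xi> by (intro scale_in U_in) auto
    have "c x * cnj (c y) * coeff_fun G ip U \<xi> \<xi> (inv y \<otimes> x) =
        ip (cscale (c x) (U x \<xi>)) (cscale (c y) (U y \<xi>))" if "x \<in> F" "y \<in> F" for x y
    proof -
      have xy: "x \<in> carrier G" "y \<in> carrier G" using that F by auto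
      \<comment> \<open>Applying the isometry \<open>U y\<close> to both arguments cancels
        \<open>inv y\<close>.\<close>
      have "ip (U (inv y \<otimes> x) \<xi>) \<xi> = ip (U y (U (inv y \<otimes> x) \<xi>)) (U y \<xi>)"
        using xy \<xi> by (intro U_isometric[symmetric] U_in) auto
      also have "U y (U (inv y \<otimes> x) \<xi>) = U x \<xi>"
        using xy \<xi> by (simp add: U_mult[symmetric] m_assoc[symmetric])
      finally show ?thesis
        using xy \<xi> by (simp add: coeff_fun_def ip_scale ip_scale_right U_in scale_in)
    qed
    then have "(\<Sum>x\<in>F. \<Sum>y\<in>F. c x * cnj (c y) * coeff_fun G ip U \<xi> \<xi> (inv y \<otimes> x)) =
        (\<Sum>x\<in>F. ip (cscale (c x) (U x \<xi>)) ?v)"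
      using F in_H by (simp add: ip_sum_right)
    also have "\<dots> = ip ?v ?v"
      using F in_H by (simp add: ip_sum_left sum_in)
    also have "ip ?v ?v \<in> \<real>\<^sub>\<ge>\<^sub>0"
      using ip_self[of ?v] in_H
      by (simp add: sum_in nonneg_Reals_of_real_iff flip: of_real_power)
    finally show ?thesis .
  qed
  then show ?thesis
    by (simp add: pos_def_funs_def T coeff_fun_def)
qed

text \<open>Each diagonal coefficient expands into four terms with factors 1, \<open>cnj c\<close>,
  \<open>c\<close> and \<open>c * cnj c\<close>. After weighting by \<open>c / 4\<close> and summing
  over the fourth roots of unity, only the \<open>cnj c\<close> term survives, because the sums of
  \<open>c\<close> and of the square of \<open>c\<close> vanish.\<close>

lemma coeff_polarization:
  assumes "\<xi> \<in> H" "\<eta> \<in> H"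
  shows "coeff_fun G ip U \<xi> \<eta> =
    (\<Sum>c\<in>{1, -1, \<i>, -\<i>}. cscale (c / 4) (coeff_fun G ip U (\<xi> + cscale c \<eta>) (\<xi> + cscale c \<eta>)))"
proof
  fix x
  let ?p = "\<lambda>c. coeff_fun G ip U (\<xi> + cscale c \<eta>) (\<xi> + cscale c \<eta>)"
  have "coeff_fun G ip U \<xi> \<eta> x = (\<Sum>c\<in>{1, -1, \<i>, -\<i>}. c / 4 * ?p c x)"
  proof (cases "x \<in> carrier G")
    case True
    have p: "?p c x =
      ip (U x \<xi>) \<xi> + cnj c * ip (U x \<xi>) \<eta> + c * ip (U x \<eta>) \<xi> + c * cnj c * ip (U x \<eta>) \<eta>" for c
      using True assms by (simp add: coeff_fun_def U_add U_scale U_in scale_in add_in ip_add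
          ip_add_right ip_scale ip_scale_right algebra_simps)
    moreover have "coeff_fun G ip U \<xi> \<eta> x = ip (U x \<xi>) \<eta>"
      using True by (simp add: coeff_fun_def)
    ultimately show ?thesis
      unfolding p by (simp add: complex_eq_iff field_simps)
  qed (simp add: coeff_fun_def)
  also have "\<dots> = (\<Sum>c\<in>{1, -1, \<i>, -\<i>}. cscale (c / 4) (?p c)) x"
    by (simp add: cscale_def complex_eq_iff)
  finally show "coeff_fun G ip U \<xi> \<eta> x =
    (\<Sum>c\<in>{1, -1, \<i>, -\<i>}. cscale (c / 4) (?p c)) x" .
qed

end

section \<open>Square-summable functions\<close>

text \<open>Vanishing off \<open>A\<close> is what makes \<open>l2_ip A\<close> definite, since that
  form sees only the values on \<open>A\<close>.\<close>

definition l2_space :: "'a set \<Rightarrow> ('a \<Rightarrow> complex) set"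
  where "l2_space A = {f. (\<forall>x. x \<notin> A \<longrightarrow> f x = 0) \<and> (\<lambda>x. (cmod (f x))\<^sup>2) summable_on A}"

definition l2_ip :: "'a set \<Rightarrow> ('a \<Rightarrow> complex) \<Rightarrow> ('a \<Rightarrow> complex) \<Rightarrow> complex"
  where "l2_ip A u v = (\<Sum>\<^sub>\<infinity>x\<in>A. u x * cnj (v x))"

lemma l2_spaceI:
  assumes "\<And>x. x \<notin> A \<Longrightarrow> f x = 0"
    and "\<And>F. finite F \<Longrightarrow> F \<subseteq> A \<Longrightarrow> (\<Sum>x\<in>F. (cmod (f x))\<^sup>2) \<le> B"
  shows "f \<in> l2_space A"
proof -
  have "(\<lambda>x. (cmod (f x))\<^sup>2) summable_on A"
    using assms(2) by (intro nonneg_bdd_above_summable_on bdd_aboveI[where M = B]) auto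
  then show ?thesis using assms(1) by (simp add: l2_space_def)
qed

lemma l2_summable: "f \<in> l2_space A \<Longrightarrow> (\<lambda>x. (cmod (f x))\<^sup>2) summable_on A"
  by (simp add: l2_space_def)

lemma l2_space_finite_support:
  assumes "finite F" "F \<subseteq> A" "\<And>x. x \<notin> F \<Longrightarrow> f x = 0"
  shows "f \<in> l2_space A"
proof -
  have "(\<lambda>x. (cmod (f x))\<^sup>2) summable_on A"
    using assms by (intro finite_nonzero_values_imp_summable_on finite_subset[OF _ assms(1)]) auto
  then show ?thesis using assms by (auto simp: l2_space_def)
qed

text \<open>Covers scalar multiples, truncations and products with bounded functions. The domination
  also forces \<open>g\<close> to vanish off \<open>A\<close>.\<close>

lemma l2_dominated:
  assumes "f \<in> l2_space A" "\<And>x. cmod (g x) \<le> C * cmod (f x)"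
  shows "g \<in> l2_space A"
proof -
  have "g x = 0" if "x \<notin> A" for x
    using assms(2)[of x] assms(1) that by (simp add: l2_space_def)
  moreover have "(\<lambda>x. (cmod (g x))\<^sup>2) summable_on A"
  proof (rule summable_on_comparison_test[where f = "\<lambda>x. C\<^sup>2 * (cmod (f x))\<^sup>2"])
    show "(\<lambda>x. C\<^sup>2 * (cmod (f x))\<^sup>2) summable_on A"
      by (intro summable_on_cmult_right l2_summable assms(1))
  qed (use power_mono[OF assms(2), of _ 2] in \<open>auto simp: power_mult_distrib\<close>)
  ultimately show ?thesis by (simp add: l2_space_def)
qed

lemma cnj_in_l2: "f \<in> l2_space A \<Longrightarrow> (\<lambda>x. cnj (f x)) \<in> l2_space A"
  by (simp add: l2_space_def)

lemma l2_subspace: "cfun.subspace (l2_space A)"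
proof (rule cfun.subspaceI)
  fix u v assume uv: "u \<in> l2_space A" "v \<in> l2_space A"
  have "(\<lambda>x. (cmod ((u + v) x))\<^sup>2) summable_on A"
  proof (rule summable_on_comparison_test[where f = "\<lambda>x. 2 * (cmod (u x))\<^sup>2 + 2 * (cmod (v x))\<^sup>2"])
    show "(\<lambda>x. 2 * (cmod (u x))\<^sup>2 + 2 * (cmod (v x))\<^sup>2) summable_on A"
      using uv by (intro summable_on_add summable_on_cmult_right l2_summable)
    fix x
    have "(cmod ((u + v) x))\<^sup>2 \<le> (cmod (u x) + cmod (v x))\<^sup>2"
      by (simp add: norm_triangle_ineq power_mono)
    also have "\<dots> \<le> 2 * (cmod (u x))\<^sup>2 + 2 * (cmod (v x))\<^sup>2"
      using sum_squares_bound[of "cmod (u x)" "cmod (v x)"] by (simp add: power2_sum)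
    finally show "(cmod ((u + v) x))\<^sup>2 \<le> 2 * (cmod (u x))\<^sup>2 + 2 * (cmod (v x))\<^sup>2" .
  qed auto
  then show "u + v \<in> l2_space A" using uv by (simp add: l2_space_def)
next
  fix c u assume "u \<in> l2_space A"
  then show "cscale c u \<in> l2_space A"
    by (rule l2_dominated[where C = "cmod c"]) (simp add: cscale_def norm_mult)
qed (simp add: l2_space_def)

lemma l2_prod_summable:
  assumes "u \<in> l2_space A" "v \<in> l2_space A"
  shows "(\<lambda>x. u x * cnj (v x)) summable_on A"
proof (rule abs_summable_summable)
  show "(\<lambda>x. norm (u x * cnj (v x))) summable_on A"
  proof (rule summable_on_comparison_test[where f = "\<lambda>x. (cmod (u x))\<^sup>2 + (cmod (v x))\<^sup>2"])
    show "(\<lambda>x. (cmod (u x))\<^sup>2 + (cmod (v x))\<^sup>2) summable_on A"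
      using assms by (intro summable_on_add l2_summable)
    fix x
    have "cmod (u x) * cmod (v x) \<le> 2 * cmod (u x) * cmod (v x)" by simp
    also have "\<dots> \<le> (cmod (u x))\<^sup>2 + (cmod (v x))\<^sup>2" by (rule sum_squares_bound)
    finally show "norm (u x * cnj (v x)) \<le> (cmod (u x))\<^sup>2 + (cmod (v x))\<^sup>2"
      by (simp add: norm_mult)
  qed auto
qed

lemma l2_ip_self: "l2_ip A u u = of_real (\<Sum>\<^sub>\<infinity>x\<in>A. (cmod (u x))\<^sup>2)"
proof -
  have "l2_ip A u u = (\<Sum>\<^sub>\<infinity>x\<in>A. of_real ((cmod (u x))\<^sup>2))"
    unfolding l2_ip_def by (intro infsum_cong) (simp flip: complex_norm_square)
  also have "\<dots> = of_real (\<Sum>\<^sub>\<infinity>x\<in>A. (cmod (u x))\<^sup>2)"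
  proof (cases "(\<lambda>x. (cmod (u x))\<^sup>2) summable_on A")
    case True
    then show ?thesis by (intro infsumI has_sum_of_real has_sum_infsum)
  next
    case False
    \<comment> \<open>Without summability both infinite sums take the default value 0; a summable
      complex series would have a summable real part.\<close>
    then have "\<not> (\<lambda>x. complex_of_real ((cmod (u x))\<^sup>2)) summable_on A"
      using summable_on_bounded_linear[OF bounded_linear_Re, of "\<lambda>x. complex_of_real ((cmod (u x))\<^sup>2)" A]
      by auto
    with False show ?thesis by (simp add: infsum_not_exists del: of_real_power)
  qed
  finally show ?thesis .
qed

lemma l2_norm: "(hnorm (l2_ip A) u)\<^sup>2 = (\<Sum>\<^sub>\<infinity>x\<in>A. (cmod (u x))\<^sup>2)"
  by (simp add: hnorm_def l2_ip_self infsum_nonneg)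

lemma l2_norm_nonneg: "hnorm (l2_ip A) u \<ge> 0"
  by (simp add: hnorm_def l2_ip_self infsum_nonneg)

lemma l2_norm_ge_sum:
  assumes "u \<in> l2_space A" "finite F" "F \<subseteq> A"
  shows "(\<Sum>x\<in>F. (cmod (u x))\<^sup>2) \<le> (hnorm (l2_ip A) u)\<^sup>2"
  unfolding l2_norm using assms by (intro finite_sum_le_infsum l2_summable) auto

lemma l2_norm_ge_point:
  assumes "u \<in> l2_space A"
  shows "cmod (u x) \<le> hnorm (l2_ip A) u"
proof (cases "x \<in> A")
  case True
  then show ?thesis
    using l2_norm_ge_sum[OF assms, of "{x}"] by (auto intro: power2_le_imp_le l2_norm_nonneg)
next
  case False
  then show ?thesis using assms l2_norm_nonneg by (auto simp: l2_space_def)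
qed

lemma l2_norm_leI:
  assumes "u \<in> l2_space A" "B \<ge> 0"
    and "\<And>F. finite F \<Longrightarrow> F \<subseteq> A \<Longrightarrow> (\<Sum>x\<in>F. (cmod (u x))\<^sup>2) \<le> B\<^sup>2"
  shows "hnorm (l2_ip A) u \<le> B"
proof -
  have "(hnorm (l2_ip A) u)\<^sup>2 \<le> B\<^sup>2"
    unfolding l2_norm by (intro infsum_le_finite_sums l2_summable assms)
  then show ?thesis using assms(2) power2_le_imp_le by blast
qed

text \<open>Point evaluations are bounded by the norm, so a Cauchy sequence has a pointwise limit.
  Bounds on finite partial sums survive this limit and give both membership and norm
  convergence.\<close>

lemma l2_complete:
  assumes X: "\<And>n. X n \<in> l2_space A"
    and Cauchy: "\<forall>e>0. \<exists>N. \<forall>m\<ge>N. \<forall>n\<ge>N. hnorm (l2_ip A) (X m - X n) < e"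
  shows "\<exists>l\<in>l2_space A. (\<lambda>n. hnorm (l2_ip A) (X n - l)) \<longlonglongrightarrow> 0"
proof -
  have diff: "X m - X n \<in> l2_space A" for m n
    by (intro cfun.subspace_diff[OF l2_subspace] X)
  have "convergent (\<lambda>n. X n x)" for x
  proof (rule Cauchy_convergent, rule metric_CauchyI)
    fix e :: real assume "e > 0"
    then obtain N where N: "\<forall>m\<ge>N. \<forall>n\<ge>N. hnorm (l2_ip A) (X m - X n) < e"
      using Cauchy by blast
    then have "dist (X m x) (X n x) < e" if "m \<ge> N" "n \<ge> N" for m n
      using l2_norm_ge_point[OF diff, of m n x] that by (fastforce simp: dist_norm)
    then show "\<exists>M. \<forall>m\<ge>M. \<forall>n\<ge>M. dist (X m x) (X n x) < e" by blast
  qed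
  then obtain l where l: "\<And>x. (\<lambda>n. X n x) \<longlonglongrightarrow> l x"
    unfolding convergent_def by metis
  have l_off: "l x = 0" if "x \<notin> A" for x
  proof -
    have "(\<lambda>n. X n x) = (\<lambda>n. 0)" using X that by (auto simp: l2_space_def)
    then show ?thesis using l[of x] by (simp add: LIMSEQ_const_iff)
  qed
  have key: "\<exists>N. \<forall>m\<ge>N. X m - l \<in> l2_space A \<and> hnorm (l2_ip A) (X m - l) \<le> e"
    if "e > 0" for e
  proof -
    obtain N where N: "\<forall>m\<ge>N. \<forall>n\<ge>N. hnorm (l2_ip A) (X m - X n) < e"
      using Cauchy \<open>e > 0\<close> by auto
    have "X m - l \<in> l2_space A \<and> hnorm (l2_ip A) (X m - l) \<le> e" if m: "m \<ge> N" for m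
    proof -
      \<comment> \<open>Let \<open>n\<close> tend to infinity in the Cauchy estimate. Restricting to
        a finite \<open>F\<close> first makes pointwise convergence sufficient.\<close>
      have le: "(\<Sum>x\<in>F. (cmod ((X m - l) x))\<^sup>2) \<le> e\<^sup>2" if F: "finite F" "F \<subseteq> A" for F
      proof (rule LIMSEQ_le_const2)
        show "(\<lambda>n. \<Sum>x\<in>F. (cmod ((X m - X n) x))\<^sup>2) \<longlonglongrightarrow> (\<Sum>x\<in>F. (cmod ((X m - l) x))\<^sup>2)"
          by (auto intro!: tendsto_intros l)
        have "(\<Sum>x\<in>F. (cmod ((X m - X n) x))\<^sup>2) \<le> e\<^sup>2" if "n \<ge> N" for n
        proof -
          have "(\<Sum>x\<in>F. (cmod ((X m - X n) x))\<^sup>2) \<le> (hnorm (l2_ip A) (X m - X n))\<^sup>2"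
            using F by (intro l2_norm_ge_sum diff)
          also have "\<dots> \<le> e\<^sup>2"
            using N m that by (intro power_mono l2_norm_nonneg) (auto simp: less_imp_le)
          finally show ?thesis .
        qed
        then show "\<exists>N. \<forall>n\<ge>N. (\<Sum>x\<in>F. (cmod ((X m - X n) x))\<^sup>2) \<le> e\<^sup>2" by blast
      qed
      have "X m - l \<in> l2_space A"
        using X l_off by (intro l2_spaceI[OF _ le]) (auto simp: l2_space_def)
      then show ?thesis using le \<open>e > 0\<close> by (auto intro: l2_norm_leI)
    qed
    then show ?thesis by blast
  qed
  \<comment> \<open>The limit is recovered as the difference of \<open>X N\<close> and
    \<open>X N - l\<close>, both of which lie in the space.\<close>
  obtain N where "X N - l \<in> l2_space A" using key[of 1] by auto
  from cfun.subspace_diff[OF l2_subspace X[of N] this] have "l \<in> l2_space A" by simp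
  moreover have "(\<lambda>n. hnorm (l2_ip A) (X n - l)) \<longlonglongrightarrow> 0"
  proof (rule LIMSEQ_I)
    fix r :: real assume "r > 0"
    \<comment> \<open>Half of \<open>r\<close>, because \<open>key\<close> yields only a weak
      inequality.\<close>
    then obtain N where "\<forall>m\<ge>N. hnorm (l2_ip A) (X m - l) \<le> r / 2" using key[of "r / 2"] by auto
    then show "\<exists>no. \<forall>n\<ge>no. norm (hnorm (l2_ip A) (X n - l) - 0) < r"
      using \<open>r > 0\<close> l2_norm_nonneg[of A] by (intro exI[of _ N]) (fastforce simp: abs_of_nonneg)
  qed
  ultimately show ?thesis by blast
qed

lemma l2_hilbert: "complex_hilbert_space (l2_space A) (l2_ip A)"
proof unfold_locales
  fix u v w assume *: "u \<in> l2_space A" "v \<in> l2_space A" "w \<in> l2_space A"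
  show "l2_ip A (u + v) w = l2_ip A u w + l2_ip A v w"
    using * by (simp add: l2_ip_def distrib_right infsum_add l2_prod_summable)
next
  fix u v c assume *: "u \<in> l2_space A" "v \<in> l2_space A"
  show "l2_ip A (cscale c u) v = c * l2_ip A u v"
    by (simp add: l2_ip_def cscale_def mult.assoc infsum_cmult_right')
next
  fix u v
  show "l2_ip A v u = cnj (l2_ip A u v)"
    by (simp add: l2_ip_def mult.commute flip: infsum_cnj)
next
  fix u assume u: "u \<in> l2_space A"
  show "Re (l2_ip A u u) \<ge> 0" by (simp add: l2_ip_self infsum_nonneg)
  assume "l2_ip A u u = 0"
  then have "hnorm (l2_ip A) u = 0" by (simp add: hnorm_def)
  then show "u = 0" using l2_norm_ge_point[OF u] by (auto simp: fun_eq_iff)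
qed (fact l2_subspace, fact l2_complete)

section \<open>The regular representation of a discrete group\<close>

lemma (in group) discrete_locally_compact_group:
  "locally_compact_group G (discrete_topology (carrier G))"
proof unfold_locales
  show "continuous_map (prod_topology (discrete_topology (carrier G)) (discrete_topology (carrier G)))
     (discrete_topology (carrier G)) (\<lambda>(x, y). x \<otimes> y)"
    by (auto simp: prod_topology_discrete_topology[symmetric])
qed (auto simp: Hausdorff_space_discrete_topology locally_compact_space_discrete_topology)

lemma (in group) inv_translation_bij:
  assumes "x \<in> carrier G"
  shows "bij_betw (\<lambda>y. inv x \<otimes> y) (carrier G) (carrier G)"
  using assms by (intro bij_betwI[where g = "\<lambda>y. x \<otimes> y"]) (auto simp: m_assoc[symmetric])

text \<open>The left regular representation. The inverse makes it multiplicative in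
  \<open>x\<close>, and the value 0 off the carrier keeps the result inside
  \<open>l2_space (carrier G)\<close>.\<close>

definition left_translation ::
    "('a, 'b) monoid_scheme \<Rightarrow> 'a \<Rightarrow> ('a \<Rightarrow> complex) \<Rightarrow> 'a \<Rightarrow> complex"
  where "left_translation G x f =
    (\<lambda>y. if y \<in> carrier G then f (inv\<^bsub>G\<^esub> x \<otimes>\<^bsub>G\<^esub> y) else 0)"

context group
begin

lemma left_translation_in_l2:
  assumes "x \<in> carrier G" "f \<in> l2_space (carrier G)"
  shows "left_translation G x f \<in> l2_space (carrier G)"
proof -
  have "(\<lambda>y. (cmod (f (inv x \<otimes> y)))\<^sup>2) summable_on carrier G"
    using summable_on_reindex_bij_betw[OF inv_translation_bij[OF assms(1)],
        of "\<lambda>y. (cmod (f y))\<^sup>2"] l2_summable[OF assms(2)] by simp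
  then show ?thesis
    by (simp add: l2_space_def left_translation_def cong: summable_on_cong)
qed

lemma left_translation_mult:
  assumes "x \<in> carrier G" "y \<in> carrier G"
  shows "left_translation G (x \<otimes> y) f = left_translation G x (left_translation G y f)"
  using assms by (auto simp: left_translation_def fun_eq_iff inv_mult_group m_assoc)

lemma left_translation_one:
  assumes "f \<in> l2_space (carrier G)"
  shows "left_translation G \<one> f = f"
  using assms by (auto simp: left_translation_def fun_eq_iff l2_space_def)

lemma regular_rep:
  "unitary_rep G (discrete_topology (carrier G)) (l2_space (carrier G)) (l2_ip (carrier G))
     (left_translation G)"
proof -
  interpret L: locally_compact_group G "discrete_topology (carrier G)"
    by (rule discrete_locally_compact_group)
  interpret complex_hilbert_space "l2_space (carrier G)" "l2_ip (carrier G)"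
    by (rule l2_hilbert)
  show ?thesis
  proof unfold_locales
    fix x assume x: "x \<in> carrier G"
    show "bij_betw (left_translation G x) (l2_space (carrier G)) (l2_space (carrier G))"
      using x by (intro bij_betwI[where g = "left_translation G (inv x)"])
        (auto simp: left_translation_in_l2 left_translation_one simp flip: left_translation_mult)
    fix u v :: "'a \<Rightarrow> complex"
    show "l2_ip (carrier G) (left_translation G x u) (left_translation G x v) = l2_ip (carrier G) u v"
      using infsum_reindex_bij_betw[OF inv_translation_bij[OF x], of "\<lambda>y. u y * cnj (v y)"]
      by (simp add: l2_ip_def left_translation_def cong: infsum_cong)
    show "((\<lambda>y. hnorm (l2_ip (carrier G)) (left_translation G y u - left_translation G x u)) \<longlongrightarrow> 0)
        (atin (discrete_topology (carrier G)) x)"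
      \<comment> \<open>The singleton \<open>{x}\<close> is open and empty once punctured, so strong
        continuity is vacuous.\<close>
      using x by (auto simp: tendsto_iff eventually_atin intro!: exI[of _ "{x}"])
  qed (simp_all add: left_translation_mult, auto simp: left_translation_def cscale_def fun_eq_iff)
qed

text \<open>Translating the point mass at \<open>\<one>\<close> by \<open>x\<close> gives the point
  mass at \<open>x\<close>, and pairing with \<open>\<eta>\<close> then picks out one value,
  conjugated because it stands in the second argument.\<close>

lemma regular_coeff_one:
  assumes \<eta>: "\<eta> \<in> l2_space (carrier G)"
  shows "coeff_fun G (l2_ip (carrier G)) (left_translation G) (\<lambda>y. if y = \<one> then 1 else 0) \<eta> = (\<lambda>x. cnj (\<eta> x))"
proof
  fix x
  show "coeff_fun G (l2_ip (carrier G)) (left_translation G) (\<lambda>y. if y = \<one> then 1 else 0) \<eta> x = cnj (\<eta> x)"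
  proof (cases "x \<in> carrier G")
    case True
    have "l2_ip (carrier G) (left_translation G x (\<lambda>y. if y = \<one> then 1 else 0)) \<eta> =
        (\<Sum>\<^sub>\<infinity>y\<in>{x}. cnj (\<eta> y))"
      unfolding l2_ip_def left_translation_def using True
      by (intro infsum_cong_neutral) (auto simp: inv_solve_left' inv_equality)
    then show ?thesis using True by (simp add: coeff_fun_def)
  qed (use \<eta> in \<open>simp add: coeff_fun_def l2_space_def\<close>)
qed

lemma delta_one_in_l2: "(\<lambda>y. if y = \<one> then 1 else 0) \<in> l2_space (carrier G)"
  by (rule l2_space_finite_support[of "{\<one>}"]) auto

lemma delta_one_norm: "hnorm (l2_ip (carrier G)) (\<lambda>y. if y = \<one> then 1 else 0) = 1"
proof -
  have "(\<Sum>\<^sub>\<infinity>y\<in>carrier G. (cmod (if y = \<one> then 1 else 0))\<^sup>2) = (\<Sum>\<^sub>\<infinity>y\<in>{\<one>}. 1::real)"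
    by (rule infsum_cong_neutral) auto
  then show ?thesis by (simp add: hnorm_def l2_ip_self)
qed

lemma l2_subset_fourier_stieltjes:
  "l2_space (carrier G) \<subseteq> fourier_stieltjes G (discrete_topology (carrier G))"
proof
  fix f assume "f \<in> l2_space (carrier G)"
  then have "(\<lambda>x. cnj (f x)) \<in> l2_space (carrier G)" by (rule cnj_in_l2)
  moreover from regular_coeff_one[OF this]
  have "f = coeff_fun G (l2_ip (carrier G)) (left_translation G)
      (\<lambda>y. if y = \<one> then 1 else 0) (\<lambda>x. cnj (f x))"
    by simp
  ultimately show "f \<in> fourier_stieltjes G (discrete_topology (carrier G))"
    unfolding fourier_stieltjes_def using regular_rep delta_one_in_l2 by blast
qed

end

lemma fourier_stieltjes_bounded:
  assumes "f \<in> fourier_stieltjes G T"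
  obtains C where "\<And>x. cmod (f x) \<le> C"
proof -
  obtain H ip U \<xi> \<eta> where *: "unitary_rep G T (H :: ('a \<Rightarrow> complex) set) ip U" "\<xi> \<in> H" "\<eta> \<in> H"
    and f: "f = coeff_fun G ip U \<xi> \<eta>"
    using assms unfolding fourier_stieltjes_def by blast
  interpret unitary_rep G T H ip U by fact
  \<comment> \<open>Nonnegativity of the bound covers the points off the carrier, where the
    coefficient is 0.\<close>
  have "hnorm ip \<xi> * hnorm ip \<eta> \<ge> 0" using ip_nonneg * by (simp add: hnorm_def)
  then show thesis
    using that[of "hnorm ip \<xi> * hnorm ip \<eta>"] cmod_coeff_le[OF *(2,3)]
    by (auto simp: f coeff_fun_def)
qed

section \<open>Haar measure and weak* convergence on a discrete group\<close>

text \<open>All subsets of the carrier are open and the compact ones are the finite ones, so outer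
  regularity is trivial and only inner regularity at infinite sets takes work. Invariance holds
  because translations are injective.\<close>

lemma (in group) discrete_haar_measure:
  "left_haar_measure G (discrete_topology (carrier G)) (count_space (carrier G))"
proof -
  let ?\<mu> = "count_space (carrier G)"
  have sets: "sets ?\<mu> = sigma_sets (carrier G) {W. W \<subseteq> carrier G}"
    using sigma_algebra.sigma_sets_eq[OF sigma_algebra_Pow[of "carrier G"]] by (simp add: Pow_def)
  have outer: "emeasure ?\<mu> A = (INF W\<in>{W. W \<subseteq> carrier G \<and> A \<subseteq> W}. emeasure ?\<mu> W)"
    if "A \<subseteq> carrier G" for A
    using that by (intro antisym INF_greatest INF_lower emeasure_mono) auto
  have inner: "emeasure ?\<mu> W = (SUP K\<in>{K. (K \<subseteq> carrier G \<and> finite K) \<and> K \<subseteq> W}. emeasure ?\<mu> K)"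
    if W: "W \<subseteq> carrier G" for W
  proof (cases "finite W")
    case True
    then show ?thesis using W by (intro antisym SUP_least SUP_upper emeasure_mono) auto
  next
    case False
    \<comment> \<open>An infinite set has finite subsets of every cardinality, so the supremum
      exceeds every natural number.\<close>
    have "(SUP K\<in>{K. (K \<subseteq> carrier G \<and> finite K) \<and> K \<subseteq> W}. emeasure ?\<mu> K) \<ge> of_nat n" for n
    proof -
      obtain K where "K \<subseteq> W" "finite K" "card K = n"
        using False infinite_arbitrarily_large by metis
      then show ?thesis using W
        by (intro SUP_upper2[of K]) (auto simp: emeasure_count_space_finite)
    qed
    then have "(SUP n. of_nat n) \<le> (SUP K\<in>{K. (K \<subseteq> carrier G \<and> finite K) \<and> K \<subseteq> W}. emeasure ?\<mu> K)"
      by (rule SUP_least)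
    then have "(SUP K\<in>{K. (K \<subseteq> carrier G \<and> finite K) \<and> K \<subseteq> W}. emeasure ?\<mu> K) = \<infinity>"
      by (simp add: ennreal_SUP_of_nat_eq_top top_unique)
    moreover have "emeasure ?\<mu> W = \<infinity>" using W False by (simp add: emeasure_count_space)
    ultimately show ?thesis by (simp only:)
  qed
  have invariant: "emeasure ?\<mu> ((\<lambda>x. g \<otimes> x) ` A) = emeasure ?\<mu> A"
    if g: "g \<in> carrier G" and A: "A \<subseteq> carrier G" for g A
  proof -
    have "inj_on (\<lambda>x. g \<otimes> x) A" using g A inj_on_cmult inj_on_subset by blast
    moreover have "(\<lambda>x. g \<otimes> x) ` A \<subseteq> carrier G" using g A by auto
    ultimately show ?thesis
      using A by (simp add: emeasure_count_space finite_image_iff card_image)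
  qed
  have nonzero: "emeasure ?\<mu> (carrier G) \<noteq> 0"
    using one_closed by (subst emeasure_count_space_eq_0) auto
  have finite: "emeasure ?\<mu> K < \<infinity>" if "K \<subseteq> carrier G" "finite K" for K
    using that by (simp add: emeasure_count_space_finite of_nat_less_top)
  show ?thesis
    unfolding left_haar_measure_def compactin_discrete_topology openin_discrete_topology
      topspace_discrete_topology
  proof (intro conjI ballI allI impI)
    show "emeasure ?\<mu> A = (INF W\<in>{W. W \<subseteq> carrier G \<and> A \<subseteq> W}. emeasure ?\<mu> W)"
      if "A \<in> sets ?\<mu>" for A
      by (rule outer) (use that in simp)
    show "emeasure ?\<mu> ((\<lambda>x. g \<otimes> x) ` A) = emeasure ?\<mu> A"
      if "g \<in> carrier G" "A \<in> sets ?\<mu>" for g A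
      by (rule invariant) (use that in simp_all)
    show "emeasure ?\<mu> (space ?\<mu>) \<noteq> 0"
      using nonzero by (simp only: space_count_space not_False_eq_True)
  qed (fact sets inner, (intro finite; blast), rule inner, assumption)
qed

section \<open>The norm of the group C*-algebra and its pairing with square-summable
  functions\<close>

lemma cstar_CauchyE:
  assumes "S \<in> cstar_Cauchy G T \<mu>" "e > 0"
  obtains N where "\<And>m n. m \<ge> N \<Longrightarrow> n \<ge> N \<Longrightarrow> cstar_norm G T \<mu> (S m - S n) < e"
proof -
  have "\<forall>e>0. \<exists>N. \<forall>m\<ge>N. \<forall>n\<ge>N. cstar_norm G T \<mu> (S m - S n) < e"
    using assms(1) unfolding cstar_Cauchy_def mem_Collect_eq by (rule conjunct2)
  then show thesis using assms(2) that by blast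
qed

text \<open>A real \<open>Sup\<close> is an upper bound only of a set bounded above. Here the bound
  is the L1-norm of \<open>f\<close>, because coefficients of vectors in the unit ball have modulus
  at most 1.\<close>

lemma cstar_norm_upper:
  fixes f :: "'a \<Rightarrow> complex"
  assumes f: "integrable (count_space (carrier G)) f"
    and rep: "unitary_rep G T (H :: ('a \<Rightarrow> complex) set) ip U"
    and \<xi>\<eta>: "\<xi> \<in> H" "\<eta> \<in> H" "hnorm ip \<xi> \<le> 1" "hnorm ip \<eta> \<le> 1"
  shows "cmod (\<integral>x. f x * ip (U x \<xi>) \<eta> \<partial>count_space (carrier G))
      \<le> cstar_norm G T (count_space (carrier G)) f"
  unfolding cstar_norm_def
proof (rule cSup_upper)
  show "bdd_above {cmod (\<integral>x. f x * ip (U x \<xi>) \<eta> \<partial>count_space (carrier G)) |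
      (H :: ('a \<Rightarrow> complex) set) ip U \<xi> \<eta>.
       unitary_rep G T H ip U \<and> \<xi> \<in> H \<and> \<eta> \<in> H \<and> hnorm ip \<xi> \<le> 1 \<and> hnorm ip \<eta> \<le> 1}"
  proof (rule bdd_aboveI, clarify)
    fix H :: "('a \<Rightarrow> complex) set" and ip U \<xi> \<eta>
    assume "unitary_rep G T H ip U" and *: "\<xi> \<in> H" "\<eta> \<in> H" "hnorm ip \<xi> \<le> 1" "hnorm ip \<eta> \<le> 1"
    then interpret unitary_rep G T H ip U by simp
    have "hnorm ip \<xi> * hnorm ip \<eta> \<le> 1"
      using * ip_nonneg by (intro mult_le_one) (auto simp: hnorm_def)
    then have le: "cmod (f x * ip (U x \<xi>) \<eta>) \<le> cmod (f x)" if "x \<in> carrier G" for x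
      using cmod_coeff_le[OF *(1,2) that] by (simp add: norm_mult mult_left_le)
    then have "integrable (count_space (carrier G)) (\<lambda>x. f x * ip (U x \<xi>) \<eta>)"
      by (intro Bochner_Integration.integrable_bound[OF f]) (auto simp: AE_count_space)
    then show "cmod (\<integral>x. f x * ip (U x \<xi>) \<eta> \<partial>count_space (carrier G))
        \<le> (\<integral>x. cmod (f x) \<partial>count_space (carrier G))"
      using f le by (intro order.trans[OF integral_norm_bound] integral_mono) auto
  qed
qed (use rep \<xi>\<eta> in blast)

text \<open>This is the domination of the norm of B(G) by the l2-norm: \<open>\<phi>\<close> is its
  own l2-norm times a coefficient of the regular representation at two unit vectors, and such a
  coefficient is admissible in the supremum defining \<open>cstar_norm\<close>.\<close>

lemma (in group) l2_pairing_le: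
  assumes f: "integrable (count_space (carrier G)) f" and \<phi>: "\<phi> \<in> l2_space (carrier G)"
  shows "cmod (\<integral>x. f x * \<phi> x \<partial>count_space (carrier G))
    \<le> cstar_norm G (discrete_topology (carrier G)) (count_space (carrier G)) f *
       hnorm (l2_ip (carrier G)) \<phi>"
proof (cases "hnorm (l2_ip (carrier G)) \<phi> = 0")
  case True
  then have "\<phi> = 0" using l2_norm_ge_point[OF \<phi>] by (auto simp: fun_eq_iff)
  then have "(\<integral>x. f x * \<phi> x \<partial>count_space (carrier G)) = 0" by simp
  then show ?thesis by (simp add: True del: zero_fun_def)
next
  case False
  define r where "r = hnorm (l2_ip (carrier G)) \<phi>"
  have r: "r > 0" using False l2_norm_nonneg[of "carrier G" \<phi>] by (simp add: r_def)
  interpret unitary_rep G "discrete_topology (carrier G)" "l2_space (carrier G)"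
    "l2_ip (carrier G)" "left_translation G" by (rule regular_rep)
  \<comment> \<open>The second unit vector; the first is the point mass at \<open>\<one>\<close>.
    The conjugate undoes the one in \<open>regular_coeff_one\<close>.\<close>
  define \<eta> where "\<eta> = cscale (of_real (1 / r)) (\<lambda>x. cnj (\<phi> x))"
  have \<eta>: "\<eta> \<in> l2_space (carrier G)"
    unfolding \<eta>_def by (intro scale_in cnj_in_l2 \<phi>)
  have "(hnorm (l2_ip (carrier G)) \<eta>)\<^sup>2 = (\<Sum>\<^sub>\<infinity>x\<in>carrier G. (1 / r)\<^sup>2 * (cmod (\<phi> x))\<^sup>2)"
    using r by (simp add: l2_norm \<eta>_def cscale_def norm_mult norm_divide power_divide)
  also have "\<dots> = (1 / r)\<^sup>2 * r\<^sup>2"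
    by (simp add: infsum_cmult_right' r_def l2_norm)
  also have "\<dots> = 1" using r by (simp add: power_divide)
  finally have norm_\<eta>: "hnorm (l2_ip (carrier G)) \<eta> = 1"
    using l2_norm_nonneg[of "carrier G" \<eta>] by (simp add: power2_eq_1_iff)
  let ?c = "\<lambda>x. l2_ip (carrier G) (left_translation G x (\<lambda>y. if y = \<one> then 1 else 0)) \<eta>"
  have c: "\<phi> x = of_real r * ?c x" if "x \<in> carrier G" for x
    using fun_cong[OF regular_coeff_one[OF \<eta>], of x] that r
    by (simp add: coeff_fun_def \<eta>_def cscale_def)
  have "(\<integral>x. f x * \<phi> x \<partial>count_space (carrier G)) =
      (\<integral>x. of_real r * (f x * ?c x) \<partial>count_space (carrier G))"
    by (rule Bochner_Integration.integral_cong) (auto simp: c)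
  then have "cmod (\<integral>x. f x * \<phi> x \<partial>count_space (carrier G)) =
      r * cmod (\<integral>x. f x * ?c x \<partial>count_space (carrier G))"
    using r by (simp add: norm_mult)
  also have "\<dots> \<le> r * cstar_norm G (discrete_topology (carrier G)) (count_space (carrier G)) f"
    using r by (intro mult_left_mono cstar_norm_upper[OF f regular_rep])
      (auto simp: \<eta> delta_one_in_l2 delta_one_norm norm_\<eta>)
  finally show ?thesis by (simp add: r_def mult.commute)
qed

section \<open>Positive definite functions on a group\<close>

text \<open>Test positivity on \<open>{\<one>, x}\<close> with weight 1 at \<open>\<one>\<close> and
  \<open>c\<close> at \<open>x\<close>. The form must be real: \<open>c = 1\<close> relates the
  imaginary parts of \<open>f x\<close> and \<open>f (inv x)\<close>, and \<open>c = \<i>\<close>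
  the real parts.\<close>

lemma (in group) pos_def_hermitian:
  assumes f: "f \<in> pos_def_funs G T" and x: "x \<in> carrier G"
  shows "f (inv x) = cnj (f x)"
proof -
  have pos: "(\<Sum>x\<in>F. \<Sum>y\<in>F. c x * cnj (c y) * f (inv y \<otimes> x)) \<in> \<real>\<^sub>\<ge>\<^sub>0"
    if "finite F" "F \<subseteq> carrier G" for F c
    using f that by (auto simp: pos_def_funs_def)
  have one: "Im (f \<one>) = 0"
    using pos[of "{\<one>}" "\<lambda>_. 1"] by (auto simp: nonneg_Reals_def)
  show ?thesis
  \<comment> \<open>For \<open>x = \<one>\<close> the two-point test set collapses, and the claim is
    that \<open>f \<one>\<close> is real.\<close>
  proof (cases "x = \<one>")
    case True
    then show ?thesis using one by (simp add: complex_eq_iff)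
  next
    case False
    have "Im (cnj c * f (inv x) + c * f x + c * cnj c * f \<one>) = 0" for c
      using pos[of "{\<one>, x}" "\<lambda>y. if y = x then c else 1"] False x one
      by (auto simp: complex_nonneg_Reals_iff algebra_simps)
    from this[of 1] this[of \<i>] show ?thesis
      using one by (simp add: complex_eq_iff)
  qed
qed

text \<open>Write \<open>f\<close> as the coefficient of the point mass at \<open>\<one>\<close> and
  the conjugate of \<open>f\<close>, then polarize. The vectors that arise are finitely supported,
  hence so are their diagonal coefficients, which therefore lie in \<open>E\<close> and are positive
  definite.\<close>

lemma (in group) finite_support_in_pos_part:
  assumes E: "\<And>f. finite {x. f x \<noteq> 0} \<Longrightarrow> {x. f x \<noteq> 0} \<subseteq> carrier G \<Longrightarrow> f \<in> E"
    and f: "finite {x. f x \<noteq> 0}" "{x. f x \<noteq> 0} \<subseteq> carrier G"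
  shows "f \<in> pos_part G (discrete_topology (carrier G)) E"
proof -
  interpret unitary_rep G "discrete_topology (carrier G)" "l2_space (carrier G)"
    "l2_ip (carrier G)" "left_translation G" by (rule regular_rep)
  let ?p = "\<lambda>\<zeta>. coeff_fun G (l2_ip (carrier G)) (left_translation G) \<zeta> \<zeta>"
  have p: "?p \<zeta> \<in> pos_part G (discrete_topology (carrier G)) E"
    if \<zeta>: "finite {x. \<zeta> x \<noteq> 0}" "{x. \<zeta> x \<noteq> 0} \<subseteq> carrier G" for \<zeta>
  proof -
    have in_l2: "\<zeta> \<in> l2_space (carrier G)"
      using \<zeta> by (intro l2_space_finite_support[of "{x. \<zeta> x \<noteq> 0}"]) auto
    \<comment> \<open>A nonzero term of the coefficient at \<open>x\<close> needs
      \<open>\<zeta>\<close> nonzero at both \<open>y\<close> and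
      \<open>z = inv x \<otimes> y\<close>, and then \<open>x = y \<otimes> inv z\<close>.\<close>
    let ?S = "(\<lambda>(y, z). y \<otimes> inv z) ` ({x. \<zeta> x \<noteq> 0} \<times> {x. \<zeta> x \<noteq> 0})"
    have "?p \<zeta> x = 0" if x: "x \<notin> ?S" for x
    proof -
      have "left_translation G x \<zeta> y * cnj (\<zeta> y) = 0" if "x \<in> carrier G" "y \<in> carrier G" for y
      proof (rule ccontr)
        assume "left_translation G x \<zeta> y * cnj (\<zeta> y) \<noteq> 0"
        then have "\<zeta> (inv x \<otimes> y) \<noteq> 0" "\<zeta> y \<noteq> 0" using that by (auto simp: left_translation_def)
        moreover have "y \<otimes> inv (inv x \<otimes> y) = x"
          using that by (simp add: inv_mult_group m_assoc[symmetric])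
        ultimately show False using x by force
      qed
      then show ?thesis
        by (simp add: coeff_fun_def l2_ip_def infsum_0)
    qed
    then have "{x. ?p \<zeta> x \<noteq> 0} \<subseteq> ?S" by blast
    moreover have "finite ?S" using \<zeta>(1) by simp
    ultimately have "finite {x. ?p \<zeta> x \<noteq> 0}" by (rule finite_subset)
    then have "?p \<zeta> \<in> E" by (intro E) (auto simp: coeff_fun_def split: if_splits)
    then show ?thesis
      unfolding pos_part_def using coeff_diag_pos_def[OF refl in_l2] by (intro cfun.span_base) auto
  qed
  let ?\<delta> = "\<lambda>y. if y = \<one> then 1 else 0 :: complex" and ?\<eta> = "\<lambda>x. cnj (f x)"
  have f_l2: "f \<in> l2_space (carrier G)"
    using f by (intro l2_space_finite_support[of "{x. f x \<noteq> 0}"]) auto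
  have "f = coeff_fun G (l2_ip (carrier G)) (left_translation G) ?\<delta> ?\<eta>"
    using regular_coeff_one[OF cnj_in_l2[OF f_l2]] by simp
  also have "\<dots> = (\<Sum>c\<in>{1, -1, \<i>, -\<i>}. cscale (c / 4) (?p (?\<delta> + cscale c ?\<eta>)))"
    by (rule coeff_polarization) (auto intro: delta_one_in_l2 cnj_in_l2 f_l2)
  also have "\<dots> \<in> pos_part G (discrete_topology (carrier G)) E"
    unfolding pos_part_def
  proof (intro cfun.span_sum cfun.span_scale)
    fix c
    have sub: "{x. (?\<delta> + cscale c ?\<eta>) x \<noteq> 0} \<subseteq> insert \<one> {x. f x \<noteq> 0}"
      by (auto simp: cscale_def)
    show "?p (?\<delta> + cscale c ?\<eta>) \<in> cfun.span (E \<inter> pos_def_funs G (discrete_topology (carrier G)))"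
      using p[of "?\<delta> + cscale c ?\<eta>"] finite_subset[OF sub] subset_trans[OF sub] f
      by (simp add: pos_part_def)
  qed
  finally show ?thesis .
qed

section \<open>Weak* convergence of square-summable functions on a discrete group\<close>

context group
begin

abbreviation (input) "DT \<equiv> discrete_topology (carrier G)"
abbreviation (input) "CM \<equiv> count_space (carrier G)"

lemma integrable_mult_l2:
  assumes "integrable CM f" "\<phi> \<in> l2_space (carrier G)"
  shows "integrable CM (\<lambda>x. f x * \<phi> x)"
proof (rule Bochner_Integration.integrable_bound)
  show "integrable CM (\<lambda>x. f x * hnorm (l2_ip (carrier G)) \<phi>)" using assms(1) by simp
  show "AE x in CM. norm (f x * \<phi> x) \<le> norm (f x * hnorm (l2_ip (carrier G)) \<phi>)"
    using l2_norm_ge_point[OF assms(2)] l2_norm_nonneg[of "carrier G" \<phi>]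
    by (auto simp: norm_mult mult_left_mono)
qed auto

lemma integral_diff_mult_l2:
  assumes "integrable CM f" "integrable CM g" "\<phi> \<in> l2_space (carrier G)"
  shows "(\<integral>x. (f - g) x * \<phi> x \<partial>CM) = (\<integral>x. f x * \<phi> x \<partial>CM) - (\<integral>x. g x * \<phi> x \<partial>CM)"
  using integrable_mult_l2[OF assms(1,3)] integrable_mult_l2[OF assms(2,3)]
  by (simp add: left_diff_distrib)

text \<open>A real \<open>Sup\<close> carries no sign by itself; the pairing inequality with the
  point mass at \<open>\<one>\<close>, of norm 1, bounds it below by a modulus.\<close>

lemma cstar_norm_nonneg: "integrable CM f \<Longrightarrow> cstar_norm G DT CM f \<ge> 0"
  using order_trans[OF norm_ge_zero l2_pairing_le[OF _ delta_one_in_l2]] by (simp add: delta_one_norm)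

text \<open>A representative belongs to its own class once the zero function has norm 0.\<close>

lemma cstar_class_nonempty:
  assumes "a \<in> group_cstar G DT CM"
  obtains S where "S \<in> a"
proof -
  obtain S where S: "S \<in> cstar_Cauchy G DT CM" and a: "a = cstar_equiv G DT CM `` {S}"
    using assms by (auto simp: group_cstar_def elim: quotientE)
  \<comment> \<open>The Cauchy condition at equal indices already bounds the norm of 0 by every
    positive \<open>e\<close>.\<close>
  have "cstar_norm G DT CM 0 < e" if e: "e > 0" for e
  proof -
    obtain N where "\<And>m n. m \<ge> N \<Longrightarrow> n \<ge> N \<Longrightarrow> cstar_norm G DT CM (S m - S n) < e"
      using cstar_CauchyE[OF S e] by metis
    then have "cstar_norm G DT CM (S N - S N) < e" by blast
    then show ?thesis by (simp only: diff_self)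
  qed
  then have "cstar_norm G DT CM 0 \<le> 0" by (meson not_le order.irrefl)
  moreover have "cstar_norm G DT CM 0 \<ge> 0" by (rule cstar_norm_nonneg) (simp add: zero_fun_def)
  ultimately have "S \<in> a" using S by (simp add: a cstar_equiv_def)
  then show thesis by (rule that)
qed

lemma cstar_class_Cauchy:
  assumes "a \<in> group_cstar G DT CM" "S \<in> a"
  shows "S \<in> cstar_Cauchy G DT CM"
  using assms by (auto simp: group_cstar_def cstar_equiv_def elim!: quotientE)

text \<open>Shows that the definite description in \<open>cstar_pairing\<close> denotes: by
  \<open>l2_pairing_le\<close> the integrals converge along one representative, and equivalent
  sequences have the same limit.\<close>

lemma cstar_pairing_tendsto:
  assumes a: "a \<in> group_cstar G DT CM" and \<phi>: "\<phi> \<in> l2_space (carrier G)" and S: "S \<in> a"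
  shows "(\<lambda>n. \<integral>x. S n x * \<phi> x \<partial>CM) \<longlonglongrightarrow> cstar_pairing CM \<phi> a"
proof -
  let ?b = "hnorm (l2_ip (carrier G)) \<phi>"
  obtain S0 where S0: "S0 \<in> cstar_Cauchy G DT CM" and a': "a = cstar_equiv G DT CM `` {S0}"
    using a by (auto simp: group_cstar_def elim: quotientE)
  have int0: "integrable CM (S0 n)" for n using S0 by (simp add: cstar_Cauchy_def)
  have "convergent (\<lambda>n. \<integral>x. S0 n x * \<phi> x \<partial>CM)"
  proof (rule Cauchy_convergent, rule metric_CauchyI)
    fix e :: real assume "e > 0"
    \<comment> \<open>The added 1 keeps the divisor positive when \<open>\<phi>\<close> is
      zero.\<close>
    then have "e / (?b + 1) > 0" using l2_norm_nonneg[of "carrier G" \<phi>] by simp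
    then obtain N where N: "\<And>m n. m \<ge> N \<Longrightarrow> n \<ge> N \<Longrightarrow> cstar_norm G DT CM (S0 m - S0 n) < e / (?b + 1)"
      using cstar_CauchyE[OF S0] by metis
    have "dist (\<integral>x. S0 m x * \<phi> x \<partial>CM) (\<integral>x. S0 n x * \<phi> x \<partial>CM) < e" if "m \<ge> N" "n \<ge> N" for m n
    proof -
      have "dist (\<integral>x. S0 m x * \<phi> x \<partial>CM) (\<integral>x. S0 n x * \<phi> x \<partial>CM) =
          cmod (\<integral>x. (S0 m - S0 n) x * \<phi> x \<partial>CM)"
        unfolding dist_norm using int0 \<phi> by (subst integral_diff_mult_l2) auto
      also have "\<dots> \<le> cstar_norm G DT CM (S0 m - S0 n) * ?b"
        by (rule l2_pairing_le[OF _ \<phi>]) (use int0 in \<open>simp add: fun_diff_def\<close>)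
      also have "\<dots> \<le> e / (?b + 1) * ?b"
        using N that by (intro mult_right_mono l2_norm_nonneg) (auto simp: less_imp_le)
      also have "\<dots> < e"
        using \<open>e > 0\<close> l2_norm_nonneg[of "carrier G" \<phi>] by (simp add: field_simps)
      finally show ?thesis .
    qed
    then show "\<exists>M. \<forall>m\<ge>M. \<forall>n\<ge>M.
        dist (\<integral>x. S0 m x * \<phi> x \<partial>CM) (\<integral>x. S0 n x * \<phi> x \<partial>CM) < e" by blast
  qed
  then obtain c where c: "(\<lambda>n. \<integral>x. S0 n x * \<phi> x \<partial>CM) \<longlonglongrightarrow> c" by (auto simp: convergent_def)
  have all: "(\<lambda>n. \<integral>x. R n x * \<phi> x \<partial>CM) \<longlonglongrightarrow> c" if "R \<in> a" for R
  proof -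
    have R: "R \<in> cstar_Cauchy G DT CM" "(\<lambda>n. cstar_norm G DT CM (S0 n - R n)) \<longlonglongrightarrow> 0"
      using that by (auto simp: a' cstar_equiv_def)
    have int: "integrable CM (R n)" for n using R by (simp add: cstar_Cauchy_def)
    have "(\<lambda>n. \<integral>x. (S0 n - R n) x * \<phi> x \<partial>CM) \<longlonglongrightarrow> 0"
    proof (rule Lim_null_comparison)
      show "\<forall>\<^sub>F n in sequentially. norm (\<integral>x. (S0 n - R n) x * \<phi> x \<partial>CM)
          \<le> cstar_norm G DT CM (S0 n - R n) * ?b"
        by (intro always_eventually allI l2_pairing_le[OF _ \<phi>])
          (use int int0 in \<open>simp add: fun_diff_def\<close>)
      show "(\<lambda>n. cstar_norm G DT CM (S0 n - R n) * ?b) \<longlonglongrightarrow> 0"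
        using tendsto_mult_right[OF R(2), of ?b] by simp
    qed
    from tendsto_diff[OF c this] show ?thesis
      by (simp add: integral_diff_mult_l2[OF int0 int \<phi>] del: minus_apply)
  qed
  \<comment> \<open>Uniqueness relies on the member \<open>S\<close>: over an empty class every
    \<open>c\<close> would qualify.\<close>
  have "\<exists>!c. \<forall>R\<in>a. (\<lambda>n. \<integral>x. R n x * \<phi> x \<partial>CM) \<longlonglongrightarrow> c"
    using all S LIMSEQ_unique by blast
  from theI'[OF this] show ?thesis using S by (simp add: cstar_pairing_def)
qed

text \<open>Each element of the C*-algebra acts as an l2-bounded functional. The constant depends on
  \<open>a\<close> alone, as a bound for the late terms of one representative.\<close>

lemma cstar_pairing_Lipschitz:
  assumes a: "a \<in> group_cstar G DT CM"
  obtains C where "\<And>\<phi> \<psi>. \<phi> \<in> l2_space (carrier G) \<Longrightarrow> \<psi> \<in> l2_space (carrier G) \<Longrightarrow>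
    cmod (cstar_pairing CM \<phi> a - cstar_pairing CM \<psi> a) \<le> C * hnorm (l2_ip (carrier G)) (\<phi> - \<psi>)"
proof -
  obtain S where S: "S \<in> a" using cstar_class_nonempty[OF a] .
  then have Cauchy: "S \<in> cstar_Cauchy G DT CM" by (rule cstar_class_Cauchy[OF a])
  then have int: "integrable CM (S n)" for n by (simp add: cstar_Cauchy_def)
  obtain N where N: "\<And>m n. m \<ge> N \<Longrightarrow> n \<ge> N \<Longrightarrow> cstar_norm G DT CM (S m - S n) < 1"
    using cstar_CauchyE[OF Cauchy zero_less_one] by metis
  \<comment> \<open>Terms after \<open>N\<close> differ from \<open>S N\<close> by less than 1 in
    norm.\<close>
  define C where "C = 1 + cstar_norm G DT CM (S N)"
  have "cmod (cstar_pairing CM \<phi> a - cstar_pairing CM \<psi> a) \<le> C * hnorm (l2_ip (carrier G)) (\<phi> - \<psi>)"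
    if *: "\<phi> \<in> l2_space (carrier G)" "\<psi> \<in> l2_space (carrier G)" for \<phi> \<psi>
  proof (rule LIMSEQ_le_const2)
    let ?b = "hnorm (l2_ip (carrier G)) (\<phi> - \<psi>)"
    have d: "\<phi> - \<psi> \<in> l2_space (carrier G)" by (intro cfun.subspace_diff[OF l2_subspace] *)
    show "(\<lambda>n. cmod ((\<integral>x. S n x * \<phi> x \<partial>CM) - (\<integral>x. S n x * \<psi> x \<partial>CM)))
      \<longlonglongrightarrow> cmod (cstar_pairing CM \<phi> a - cstar_pairing CM \<psi> a)"
      by (rule tendsto_norm[OF tendsto_diff[OF cstar_pairing_tendsto[OF a *(1) S]
              cstar_pairing_tendsto[OF a *(2) S]]])
    have "cmod ((\<integral>x. S n x * \<phi> x \<partial>CM) - (\<integral>x. S n x * \<psi> x \<partial>CM)) \<le> C * ?b" if "n \<ge> N" for n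
    proof -
      have "(\<integral>x. S n x * \<phi> x \<partial>CM) - (\<integral>x. S n x * \<psi> x \<partial>CM) = (\<integral>x. S n x * (\<phi> - \<psi>) x \<partial>CM)"
        using integrable_mult_l2[OF int *(1)] integrable_mult_l2[OF int *(2)]
        by (simp add: right_diff_distrib)
      \<comment> \<open>The split is made at the level of integrals, so that the triangle inequality
        is that of the complex numbers and not of \<open>cstar_norm\<close>.\<close>
      also have "\<dots> = (\<integral>x. (S n - S N) x * (\<phi> - \<psi>) x \<partial>CM) + (\<integral>x. S N x * (\<phi> - \<psi>) x \<partial>CM)"
        using integral_diff_mult_l2[OF int[of n] int[of N] d] by (simp only: diff_add_cancel)
      finally have "cmod ((\<integral>x. S n x * \<phi> x \<partial>CM) - (\<integral>x. S n x * \<psi> x \<partial>CM))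
          \<le> cmod (\<integral>x. (S n - S N) x * (\<phi> - \<psi>) x \<partial>CM) + cmod (\<integral>x. S N x * (\<phi> - \<psi>) x \<partial>CM)"
        by (simp only: norm_triangle_ineq)
      also have "\<dots> \<le> cstar_norm G DT CM (S n - S N) * ?b + cstar_norm G DT CM (S N) * ?b"
        by (intro add_mono l2_pairing_le[OF _ d] int)
          (use int in \<open>simp add: fun_diff_def\<close>)
      also have "\<dots> \<le> C * ?b"
        unfolding C_def distrib_right
        by (rule add_right_mono, rule mult_right_mono)
          (rule less_imp_le[OF N[OF that order.refl]], rule l2_norm_nonneg)
      finally show ?thesis .
    qed
    then show "\<exists>N. \<forall>n\<ge>N. cmod ((\<integral>x. S n x * \<phi> x \<partial>CM) - (\<integral>x. S n x * \<psi> x \<partial>CM)) \<le> C * ?b"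
      by blast
  qed
  then show thesis by (rule that[of C])
qed

text \<open>By the Lipschitz bound, l2-convergence gives convergence of the pairing with every
  \<open>a\<close>, which is convergence in the product topology that the weak* topology is pulled
  back from. A general filter allows limits along finite subsets.\<close>

lemma l2_limit_in_weak_star_closure:
  assumes "F \<noteq> bot" and \<phi>: "\<phi> \<in> l2_space (carrier G)"
    and g: "\<And>i. g i \<in> l2_space (carrier G)"
    and S: "\<forall>\<^sub>F i in F. g i \<in> S"
    and lim: "((\<lambda>i. hnorm (l2_ip (carrier G)) (g i - \<phi>)) \<longlongrightarrow> 0) F"
  shows "\<phi> \<in> weak_star_topology G DT CM closure_of S"
proof -
  let ?I = "group_cstar G DT CM" and ?B = "fourier_stieltjes G DT"
  let ?P = "product_topology (\<lambda>_. euclidean :: complex topology) ?I"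
  let ?ev = "\<lambda>\<phi>. \<lambda>a\<in>?I. cstar_pairing CM \<phi> a"
  have fs: "f \<in> ?B" if "f \<in> l2_space (carrier G)" for f
    using l2_subset_fourier_stieltjes that by (rule subsetD)
  have "((\<lambda>i. cstar_pairing CM (g i) a) \<longlongrightarrow> cstar_pairing CM \<phi> a) F" if a: "a \<in> ?I" for a
  proof -
    obtain C where C: "\<And>\<phi> \<psi>. \<phi> \<in> l2_space (carrier G) \<Longrightarrow> \<psi> \<in> l2_space (carrier G) \<Longrightarrow>
        cmod (cstar_pairing CM \<phi> a - cstar_pairing CM \<psi> a) \<le> C * hnorm (l2_ip (carrier G)) (\<phi> - \<psi>)"
      using cstar_pairing_Lipschitz[OF a] by blast
    have "((\<lambda>i. cstar_pairing CM (g i) a - cstar_pairing CM \<phi> a) \<longlongrightarrow> 0) F"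
      by (rule Lim_null_comparison[OF always_eventually tendsto_mult_right_zero[OF lim]])
        (use C g \<phi> in blast)
    then show ?thesis by (rule LIM_zero_cancel)
  qed
  then have "limitin ?P (\<lambda>i. ?ev (g i)) (?ev \<phi>) F"
    by (auto simp: limitin_componentwise)
  then have ev: "\<forall>\<^sub>F i in F. ?ev (g i) \<in> V" if "openin ?P V" "?ev \<phi> \<in> V" for V
    using that by (auto simp: limitin_def)
  show ?thesis
    unfolding in_closure_of weak_star_topology_def topspace_pullback_topology openin_pullback_topology
  proof (intro conjI allI impI)
    show "\<phi> \<in> ?ev -` topspace ?P \<inter> ?B" using fs[OF \<phi>] by auto
    fix W assume "\<phi> \<in> W \<and> (\<exists>V. openin ?P V \<and> W = ?ev -` V \<inter> ?B)"
    then obtain V where V: "openin ?P V" "W = ?ev -` V \<inter> ?B" "?ev \<phi> \<in> V" by auto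
    \<comment> \<open>Nontriviality of \<open>F\<close> turns two eventual properties into one index
      that satisfies both.\<close>
    from eventually_happens[OF eventually_conj[OF S ev[OF V(1,3)]]] \<open>F \<noteq> bot\<close>
    obtain i where "g i \<in> S" "?ev (g i) \<in> V" by auto
    then show "\<exists>y. y \<in> S \<and> y \<in> W" using V(2) fs[OF g] by auto
  qed
qed

text \<open>The truncations of \<open>f\<close> to finite sets lie in \<open>pos_part\<close> and
  approximate \<open>f\<close> in l2-norm: the squared distance is the tail of the series of
  squares.\<close>

lemma weakly_ordered_of_finite_support:
  assumes E_l2: "E \<subseteq> l2_space (carrier G)"
    and E: "\<And>f. finite {x. f x \<noteq> 0} \<Longrightarrow> {x. f x \<noteq> 0} \<subseteq> carrier G \<Longrightarrow> f \<in> E"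
  shows "weakly_ordered G DT CM E"
  unfolding weakly_ordered_def
proof
  fix f assume "f \<in> E"
  then have f: "f \<in> l2_space (carrier G)" using E_l2 by blast
  let ?g = "\<lambda>F x. if x \<in> F then f x else 0"
  have g: "?g F \<in> l2_space (carrier G)" for F
    using f by (rule l2_dominated[where C = 1]) auto
  have "(hnorm (l2_ip (carrier G)) (?g F - f))\<^sup>2 =
      (\<Sum>\<^sub>\<infinity>x\<in>carrier G. (cmod (f x))\<^sup>2) - (\<Sum>x\<in>F. (cmod (f x))\<^sup>2)"
    if F: "finite F" "F \<subseteq> carrier G" for F
  proof -
    have "(hnorm (l2_ip (carrier G)) (?g F - f))\<^sup>2 = (\<Sum>\<^sub>\<infinity>x\<in>carrier G - F. (cmod (f x))\<^sup>2)"
      unfolding l2_norm by (rule infsum_cong_neutral) auto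
    also have "\<dots> = (\<Sum>\<^sub>\<infinity>x\<in>carrier G. (cmod (f x))\<^sup>2) - (\<Sum>\<^sub>\<infinity>x\<in>F. (cmod (f x))\<^sup>2)"
      using F l2_summable[OF f] by (intro infsum_Diff) auto
    finally show ?thesis using F by simp
  qed
  then have "\<forall>\<^sub>F F in finite_subsets_at_top (carrier G). hnorm (l2_ip (carrier G)) (?g F - f) =
      sqrt ((\<Sum>\<^sub>\<infinity>x\<in>carrier G. (cmod (f x))\<^sup>2) - (\<Sum>x\<in>F. (cmod (f x))\<^sup>2))"
    using l2_norm_nonneg[of "carrier G"]
    by (intro eventually_finite_subsets_at_top_weakI real_sqrt_unique[symmetric]) auto
  \<comment> \<open>Partial sums tend to the infinite sum along the filter of finite subsets, so the
    tail under the root tends to 0.\<close>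
  moreover have "((\<lambda>F. sqrt ((\<Sum>\<^sub>\<infinity>x\<in>carrier G. (cmod (f x))\<^sup>2) - (\<Sum>x\<in>F. (cmod (f x))\<^sup>2))) \<longlongrightarrow> sqrt 0)
      (finite_subsets_at_top (carrier G))"
    using tendsto_diff[OF tendsto_const infsum_tendsto[OF l2_summable[OF f]]]
    by (intro tendsto_real_sqrt) (metis diff_self)
  ultimately have "((\<lambda>F. hnorm (l2_ip (carrier G)) (?g F - f)) \<longlongrightarrow> 0) (finite_subsets_at_top (carrier G))"
    by (simp add: tendsto_cong)
  moreover have "\<forall>\<^sub>F F in finite_subsets_at_top (carrier G). ?g F \<in> pos_part G DT E"
    by (intro eventually_finite_subsets_at_top_weakI finite_support_in_pos_part E)
      (auto intro: rev_finite_subset)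
  ultimately show "f \<in> weak_star_topology G DT CM closure_of pos_part G DT E"
    by (intro l2_limit_in_weak_star_closure[where g = ?g, OF _ f g]) auto
qed

end

section \<open>The integers\<close>

text \<open>The integers are embedded in the reals, the element type used in the final
  statement.\<close>

abbreviation Z_group :: "real monoid"
  where "Z_group \<equiv> \<lparr>carrier = \<int>, mult = (+), one = 0\<rparr>"

lemma group_Z: "group Z_group"
  by (rule groupI) (auto intro: bexI[of _ "- _"])

lemma inv_Z: "x \<in> \<int> \<Longrightarrow> inv\<^bsub>Z_group\<^esub> x = - x"
  using group.inv_equality[OF group_Z, of "- x" x] by simp

text \<open>The support condition is one-sided: translations and multiplication preserve it, the
  reflection of the integers at 0 does not.\<close>

definition l2_bounded_below :: "(real \<Rightarrow> complex) set"
  where "l2_bounded_below = {f \<in> l2_space \<int>. \<exists>K. \<forall>x<K. f x = 0}"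

lemma subspace_l2_bounded_below: "cfun.subspace l2_bounded_below"
proof (rule cfun.subspaceI)
  fix f g assume "f \<in> l2_bounded_below" "g \<in> l2_bounded_below"
  then obtain K L where "f \<in> l2_space \<int>" "g \<in> l2_space \<int>" "\<forall>x<K. f x = 0" "\<forall>x<L. g x = 0"
    by (auto simp: l2_bounded_below_def)
  then show "f + g \<in> l2_bounded_below"
    by (auto simp: l2_bounded_below_def cfun.subspace_add[OF l2_subspace] intro!: exI[of _ "min K L"])
next
  fix c f assume "f \<in> l2_bounded_below"
  then show "cscale c f \<in> l2_bounded_below"
    using cfun.subspace_scale[OF l2_subspace] by (auto simp: l2_bounded_below_def cscale_def)
qed (use cfun.subspace_0[OF l2_subspace] in \<open>auto simp: l2_bounded_below_def\<close>)

lemma fs_ideal_l2_bounded_below: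
  "fs_ideal Z_group (discrete_topology \<int>) l2_bounded_below"
  unfolding fs_ideal_def
proof (intro conjI ballI)
  show "l2_bounded_below \<subseteq> fourier_stieltjes Z_group (discrete_topology \<int>)"
    using group.l2_subset_fourier_stieltjes[OF group_Z] by (auto simp: l2_bounded_below_def)
  fix b f assume b: "b \<in> fourier_stieltjes Z_group (discrete_topology \<int>)" and f: "f \<in> l2_bounded_below"
  obtain C where "\<And>x. cmod (b x) \<le> C" using fourier_stieltjes_bounded[OF b] by metis
  then have "b * f \<in> l2_space \<int>"
    using f by (rule_tac l2_dominated[where f = f and C = C])
      (auto simp: l2_bounded_below_def norm_mult mult_right_mono)
  then show "b * f \<in> l2_bounded_below" using f by (auto simp: l2_bounded_below_def)
qed (rule subspace_l2_bounded_below)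

lemma invariant_l2_bounded_below: "G_invariant Z_group l2_bounded_below"
proof -
  have "(\<lambda>x. if x \<in> \<int> then f (g + x) else 0) \<in> l2_bounded_below"
    if g: "g \<in> \<int>" and f: "f \<in> l2_bounded_below" for g f
  proof -
    \<comment> \<open>Rewriting the translate through the regular representation reuses its
      invariance of the l2-space.\<close>
    have "left_translation Z_group (- g) f = (\<lambda>x. if x \<in> \<int> then f (g + x) else 0)"
      using g by (auto simp: left_translation_def inv_Z)
    then have "(\<lambda>x. if x \<in> \<int> then f (g + x) else 0) \<in> l2_space \<int>"
      using group.left_translation_in_l2[OF group_Z, of "- g" f] g f
      by (simp add: l2_bounded_below_def)
    moreover obtain K where "\<forall>x<K. f x = 0" using f by (auto simp: l2_bounded_below_def)
    ultimately show ?thesis by (auto simp: l2_bounded_below_def intro!: exI[of _ "K - g"])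
  qed
  \<comment> \<open>The group is abelian, so right translates are left translates.\<close>
  then show ?thesis by (simp add: G_invariant_def add.commute cong: if_cong)
qed

lemma weakly_ordered_l2_bounded_below:
  "weakly_ordered Z_group (discrete_topology \<int>) (count_space \<int>) l2_bounded_below"
proof -
  have "f \<in> l2_bounded_below" if f: "finite {x. f x \<noteq> 0}" "{x. f x \<noteq> 0} \<subseteq> \<int>" for f
  proof -
    \<comment> \<open>Inserting 0 keeps \<open>Min\<close> meaningful for the zero function.\<close>
    have "\<forall>x<Min (insert 0 {x. f x \<noteq> 0}). f x = 0"
      using f(1) by auto
    moreover have "f \<in> l2_space \<int>" using f by (intro l2_space_finite_support[of "{x. f x \<noteq> 0}"]) auto
    ultimately show ?thesis unfolding l2_bounded_below_def by blast
  qed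
  moreover have "l2_bounded_below \<subseteq> l2_space \<int>" by (auto simp: l2_bounded_below_def)
  ultimately show ?thesis
    using group.weakly_ordered_of_finite_support[OF group_Z, of l2_bounded_below] by simp
qed

section \<open>Failure of the order property\<close>

text \<open>Finitely supported functions form a subspace, so only the positive definite members need
  checking. Hermitian symmetry reflects the lower bound of the support into an upper bound.\<close>

lemma pos_part_l2_bounded_below_finite:
  assumes "f \<in> pos_part Z_group T l2_bounded_below"
  shows "finite {x. f x \<noteq> 0}"
proof -
  let ?V = "{f :: real \<Rightarrow> complex. finite {x. f x \<noteq> 0}}"
  have "cfun.subspace ?V"
  proof (rule cfun.subspaceI)
    fix f g :: "real \<Rightarrow> complex" assume "f \<in> ?V" "g \<in> ?V"
    moreover have "{x. (f + g) x \<noteq> 0} \<subseteq> {x. f x \<noteq> 0} \<union> {x. g x \<noteq> 0}" by auto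
    ultimately show "f + g \<in> ?V" using finite_subset by blast
  next
    fix c and f :: "real \<Rightarrow> complex" assume "f \<in> ?V"
    moreover have "{x. cscale c f x \<noteq> 0} \<subseteq> {x. f x \<noteq> 0}" by (auto simp: cscale_def)
    ultimately show "cscale c f \<in> ?V" using finite_subset by blast
  qed simp
  moreover have "l2_bounded_below \<inter> pos_def_funs Z_group T \<subseteq> ?V"
  proof
    fix f assume f: "f \<in> l2_bounded_below \<inter> pos_def_funs Z_group T"
    then obtain K where K: "\<forall>x<K. f x = 0" by (auto simp: l2_bounded_below_def)
    have "x \<in> \<int> \<and> \<bar>x\<bar> \<le> \<bar>K\<bar>" if "f x \<noteq> 0" for x
    proof -
      have x: "x \<in> \<int>" using f that by (auto simp: l2_bounded_below_def l2_space_def)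
      then have "f (- x) = cnj (f x)"
        using group.pos_def_hermitian[OF group_Z, of f T x] f by (simp add: inv_Z)
      \<comment> \<open>Both bounds together say \<open>K \<le> x \<le> - K\<close>, which confines
        \<open>x\<close> to finitely many integers.\<close>
      then have "\<not> x < K" "\<not> - x < K" using K that by auto
      then show ?thesis using x by auto
    qed
    then show "f \<in> ?V"
      using finite_subset[OF _ finite_abs_int_segment[of "\<bar>K\<bar>"], of "{x. f x \<noteq> 0}"] by blast
  qed
  ultimately have "cfun.span (l2_bounded_below \<inter> pos_def_funs Z_group T) \<subseteq> ?V"
    by (intro cfun.span_minimal)
  then show ?thesis using assms by (auto simp: pos_part_def)
qed

lemma not_ordered_l2_bounded_below: "\<not> ordered Z_group T l2_bounded_below"
proof
  assume "ordered Z_group T l2_bounded_below"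
  \<comment> \<open>A geometric sequence on the naturals: square-summable, zero below 0, nowhere
    zero on an infinite set. \<open>nat \<lfloor>x\<rfloor>\<close> recovers the exponent from its
    real image.\<close>
  define f :: "real \<Rightarrow> complex" where "f = (\<lambda>x. if x \<in> \<nat> then (1 / 2) ^ nat \<lfloor>x\<rfloor> else 0)"
  have "(\<lambda>n::nat. (1 / 4 :: real) ^ n) summable_on UNIV"
    by (subst summable_on_UNIV_nonneg_real_iff) (auto intro: summable_geometric)
  \<comment> \<open>The squares form the geometric series of ratio 1/4; it is carried along the
    embedding \<open>real\<close> and then extended by zero to \<open>\<int>\<close>.\<close>
  then have "(\<lambda>x. (cmod (f x))\<^sup>2) summable_on range real"
    by (subst summable_on_reindex)
      (auto simp: f_def o_def norm_power norm_divide inj_on_def power2_eq_square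
        simp flip: power_mult_distrib)
  then have "(\<lambda>x. (cmod (f x))\<^sup>2) summable_on \<int>"
    by (subst summable_on_cong_neutral[where T = "range real"]) (auto simp: f_def Nats_def)
  then have "f \<in> l2_bounded_below"
    by (auto simp: l2_bounded_below_def l2_space_def f_def Nats_subset_Ints[THEN subsetD]
        intro!: exI[of _ 0] elim: Nats_cases)
  then have "finite {x. f x \<noteq> 0}"
    using pos_part_l2_bounded_below_finite \<open>ordered Z_group T l2_bounded_below\<close>
    unfolding ordered_def by blast
  moreover have "range real \<subseteq> {x. f x \<noteq> 0}" by (auto simp: f_def)
  ultimately have "finite (range real)" using finite_subset by blast
  then show False using finite_imageD[of real UNIV] by (simp add: inj_on_def)
qed

theorem corollary4p6:
  shows "\<exists>(G :: real monoid) T \<mu> E.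
    locally_compact_group G T \<and> left_haar_measure G T \<mu> \<and>
    fs_ideal G T E \<and> G_invariant G E \<and>
    weakly_ordered G T \<mu> E \<and> \<not> ordered G T E"
  using group.discrete_locally_compact_group[OF group_Z] group.discrete_haar_measure[OF group_Z]
    fs_ideal_l2_bounded_below invariant_l2_bounded_below weakly_ordered_l2_bounded_below
    not_ordered_l2_bounded_below
  by (intro exI[of _ Z_group] exI[of _ "discrete_topology \<int>"] exI[of _ "count_space \<int>"]
      exI[of _ l2_bounded_below]) auto

end
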